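(* Let $\mathcal{C}$ be a class of subsets of $\mathbb{R}^n$ endowed with a distance $\delta$, and let $J$ and $F$ be two shape functionals, i.e. real-valued functions on $\mathcal{C}$. Set $I:=\{F(\Omega)\ |\ \Omega\in\mathcal{C}\}$ and assume that: (A) The class $\mathcal{C}$ is non-empty and compact with respect to the distance $\delta$. (B) The functionals $F$ and $J$ are not constant and are continuous on $\mathcal{C}$ with respect to $\delta$. (C) For every $\Omega\in\mathcal{C}$ there exist $\varepsilon_\Omega>0$ and a continuous map $\Psi_\Omega:[\inf I,\sup I]\cap(F(\Omega)-\varepsilon_\Omega,F(\Omega)+\varepsilon_\Omega)\to\mathcal{C}$ such that $\Psi_\Omega(F(\Omega))=\Omega$ and, for all $x\in[\inf I,\sup I]\cap(F(\Omega)-\varepsilon_\Omega,F(\Omega)+\varepsilon_\Omega)$, $F(\Psi_\Omega(x))=x$. (D) A set $\Omega\in\mathcal{C}$ such that $F(\Omega)<\sup I$ cannot be a local minimizer of $J$ in $(\mathcal{C},\delta)$. Then: (1) The set $I$ is a closed interval with non-empty interior: it is exactly the closure of the interval $(\inf I,\sup I)$. (2) For every $x\in I$, the problem $\inf\{J(\Omega)\ |\ \Omega\in\mathcal{C}\ \text{and}\ F(\Omega)=x\}$ admits solutions. (3) The function $f:x\in I\longmapsto\min\{J(\Omega)\ |\ \Omega\in\mathcal{C}\ \text{and}\ F(\Omega)=x\}$ is continuous and strictly decreasing. (4) For every $x\in I$, the following four problems are equivalent: - $\min\{J(\Omega)\ |\ \Omega\in\mathcal{C}\ \text{and}\ F(\Omega)=x\}$,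 - $\min\{J(\Omega)\ |\ \Omega\in\mathcal{C}\ \text{and}\ F(\Omega)\le x\}$, - $\min\{F(\Omega)\ |\ \Omega\in\mathcal{C}\ \text{and}\ J(\Omega)=f(x)\}$, - $\min\{F(\Omega)\ |\ \Omega\in\mathcal{C}\ \text{and}\ J(\Omega)\le f(x)\}$.
   Context: Problems are called equivalent if any solution (minimizer) of one of them is also a solution of each of the others. A local minimizer of $J$ in $(\mathcal{C},\delta)$ is a set $\Omega\in\mathcal{C}$ for which there is $r>0$ such that $J(\Omega)\le J(\Omega')$ for all $\Omega'\in\mathcal{C}$ with $\delta(\Omega,\Omega')<r$. *)

theory Defs
  imports "HOL-Analysis.Analysis"
begin

text \<open>A minimization problem is a pair of an objective function and an admissible set.\<close>

type_synonym 'a min_problem = "('a \<Rightarrow> real) \<times> 'a set"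

definition is_solution :: "'a min_problem \<Rightarrow> 'a \<Rightarrow> bool" where
  "is_solution P \<Omega> \<longleftrightarrow> is_arg_min (fst P) (\<lambda>\<Omega>'. \<Omega>' \<in> snd P) \<Omega>"

text \<open>The minimum is the least attained value. If the objective has no minimum on the admissible
  set, the value is unspecified.\<close>

definition min_value :: "'a min_problem \<Rightarrow> real" where
  "min_value P = (LEAST y. y \<in> fst P ` snd P)"

definition equivalent_problems :: "'a min_problem set \<Rightarrow> bool" where
  "equivalent_problems \<P> \<longleftrightarrow>
     (\<forall>P\<in>\<P>. \<forall>\<Omega>. is_solution P \<Omega> \<longrightarrow> (\<forall>Q\<in>\<P>. is_solution Q \<Omega>))"

definition local_minimizer :: "'a set \<Rightarrow> ('a \<Rightarrow> 'a \<Rightarrow> real) \<Rightarrow> ('a \<Rightarrow> real) \<Rightarrow> 'a \<Rightarrow> bool" where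
  "local_minimizer C \<delta> J \<Omega> \<longleftrightarrow>
     \<Omega> \<in> C \<and> (\<exists>r>0. \<forall>\<Omega>'\<in>C. \<delta> \<Omega> \<Omega>' < r \<longrightarrow> J \<Omega> \<le> J \<Omega>')"

definition constrained_min ::
    "'a set \<Rightarrow> ('a \<Rightarrow> real) \<Rightarrow> ('a \<Rightarrow> real) \<Rightarrow> real \<Rightarrow> real" where
  "constrained_min C J F x = min_value (J, {\<Omega>\<in>C. F \<Omega> = x})"

end

theory Submission
  imports Defs
begin

text \<open>The constraint \<open>F \<Omega> \<le> x\<close> is always saturated by a minimizer of \<open>J\<close>: if \<open>F \<Omega> < x\<close>, then
  \<open>{F < x}\<close> is a neighbourhood of \<open>\<Omega>\<close> on which \<open>\<Omega>\<close> is optimal, so \<open>\<Omega>\<close> would be a local minimizer.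
  This yields strict monotonicity of \<open>f\<close> and the equivalence of the four problems, whose common
  solutions are the \<open>\<Omega>\<close> with \<open>F \<Omega> = x\<close> and \<open>J \<Omega> = f x\<close>. The local right inverses of \<open>F\<close>
  make the range of \<open>F\<close> open in \<open>[inf I, sup I]\<close> and \<open>f\<close> upper semicontinuous; compactness makes
  the range closed and \<open>f\<close> lower semicontinuous.\<close>

section \<open>Solutions and minimum values\<close>

lemma is_solution_iff:
  "is_solution (g, S) \<Omega> \<longleftrightarrow> \<Omega> \<in> S \<and> (\<forall>\<Omega>'\<in>S. g \<Omega> \<le> g \<Omega>')"
  by (auto simp: is_solution_def is_arg_min_linorder)

lemma is_solution_iff_eq:
  assumes "is_solution (g, S) \<Omega>\<^sub>0"
  shows "is_solution (g, S) \<Omega> \<longleftrightarrow> \<Omega> \<in> S \<and> g \<Omega> = g \<Omega>\<^sub>0"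
  using assms by (auto simp: is_solution_iff intro: antisym)

lemma min_value_eq:
  assumes "is_solution (g, S) \<Omega>"
  shows "min_value (g, S) = g \<Omega>"
  using assms unfolding min_value_def is_solution_iff
  by (auto intro!: Least_equality)

lemma compact_space_has_solution:
  fixes g :: "'a \<Rightarrow> real"
  assumes "compact_space X" "continuous_map X euclideanreal g" "closedin X S" "S \<noteq> {}"
  shows "\<exists>\<Omega>. is_solution (g, S) \<Omega>"
proof -
  have "compactin X S"
    using assms closedin_compact_space by blast
  then have "compact (g ` S)"
    using image_compactin[OF _ assms(2)] by (simp add: compactin_euclidean_iff)
  with \<open>S \<noteq> {}\<close> obtain y where "y \<in> g ` S" "\<forall>z\<in>g ` S. y \<le> z"
    using compact_attains_inf[of "g ` S"] by auto
  then show ?thesis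
    by (auto simp: is_solution_iff)
qed

text \<open>Only the metric structure of the class matters for the argument, so its members have an
  arbitrary type.\<close>

locale constrained_problem = Metric_space C \<delta>
  for C :: "'a set" and \<delta> :: "'a \<Rightarrow> 'a \<Rightarrow> real" +
  fixes J F :: "'a \<Rightarrow> real"
  assumes compact: "compact_space mtopology"
    and cont_F: "continuous_map mtopology euclideanreal F"
    and cont_J: "continuous_map mtopology euclideanreal J"
    and F_not_constant: "\<not> F constant_on C"
    and local_right_inverse: "\<And>\<Omega>. \<Omega> \<in> C \<Longrightarrow> \<exists>\<epsilon>>0. \<exists>\<Psi>.
          continuous_map
            (top_of_set ({Inf (F ` C)..Sup (F ` C)} \<inter> {F \<Omega> - \<epsilon><..<F \<Omega> + \<epsilon>})) mtopology \<Psi> \<and>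
          \<Psi> (F \<Omega>) = \<Omega> \<and>
          (\<forall>x \<in> {Inf (F ` C)..Sup (F ` C)} \<inter> {F \<Omega> - \<epsilon><..<F \<Omega> + \<epsilon>}. F (\<Psi> x) = x)"
    and no_local_minimizer:
      "\<And>\<Omega>. \<Omega> \<in> C \<Longrightarrow> F \<Omega> < Sup (F ` C) \<Longrightarrow> \<not> local_minimizer C \<delta> J \<Omega>"
begin

abbreviation f :: "real \<Rightarrow> real" where
  "f \<equiv> constrained_min C J F"

section \<open>The range of \<open>F\<close>\<close>

lemma compact_range: "compact (F ` C)"
proof -
  have "compactin mtopology C"
    using compact by (simp add: compact_space_def)
  then show ?thesis
    using image_compactin[OF _ cont_F] by (simp add: compactin_euclidean_iff)
qed

lemma range_bounds:
  assumes "\<Omega> \<in> C"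
  shows "Inf (F ` C) \<le> F \<Omega>" "F \<Omega> \<le> Sup (F ` C)"
  using assms compact_imp_bounded[OF compact_range]
  by (simp_all add: cInf_lower cSup_upper bounded_imp_bdd_above bounded_imp_bdd_below)

lemma Inf_less_Sup: "Inf (F ` C) < Sup (F ` C)"
proof (rule ccontr)
  assume "\<not> ?thesis"
  then have "F \<Omega> = Inf (F ` C)" if "\<Omega> \<in> C" for \<Omega>
    using range_bounds[OF that] by linarith
  then show False
    using F_not_constant unfolding constant_on_def by blast
qed

text \<open>A continuous map into \<open>mtopology\<close> takes its values in the carrier
  \<open>C\<close>, so each \<open>\<Psi> x\<close> is an admissible competitor at the level
  \<open>x\<close>.\<close>

lemma local_section:
  assumes "\<Omega> \<in> C"
  obtains \<epsilon> \<Psi> where "\<epsilon> > 0" "\<Psi> (F \<Omega>) = \<Omega>"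
    "continuous_map
       (top_of_set ({Inf (F ` C)..Sup (F ` C)} \<inter> {F \<Omega> - \<epsilon><..<F \<Omega> + \<epsilon>})) mtopology \<Psi>"
    "\<And>x. x \<in> {Inf (F ` C)..Sup (F ` C)} \<inter> {F \<Omega> - \<epsilon><..<F \<Omega> + \<epsilon>} \<Longrightarrow> \<Psi> x \<in> C \<and> F (\<Psi> x) = x"
proof -
  obtain \<epsilon> \<Psi> where *: "\<epsilon> > 0" "\<Psi> (F \<Omega>) = \<Omega>"
    "continuous_map
       (top_of_set ({Inf (F ` C)..Sup (F ` C)} \<inter> {F \<Omega> - \<epsilon><..<F \<Omega> + \<epsilon>})) mtopology \<Psi>"
    "\<forall>x \<in> {Inf (F ` C)..Sup (F ` C)} \<inter> {F \<Omega> - \<epsilon><..<F \<Omega> + \<epsilon>}. F (\<Psi> x) = x"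
    using local_right_inverse[OF assms] by blast
  from continuous_map_funspace[OF *(3)] *(4) show ?thesis
    by (intro that[OF *(1-3)]) auto
qed

text \<open>A nonempty subset that is both open and closed in a connected interval is the whole
  interval. Closedness comes from compactness; openness holds because a local right inverse reaches
  every nearby level of the interval.\<close>

lemma range_eq: "F ` C = {Inf (F ` C)..Sup (F ` C)}"
proof -
  let ?K = "{Inf (F ` C)..Sup (F ` C)}"
  have sub: "F ` C \<subseteq> ?K"
    using range_bounds by auto
  have "openin (top_of_set ?K) (F ` C)"
    unfolding openin_contains_ball
  proof (intro conjI ballI sub)
    fix y assume "y \<in> F ` C"
    then obtain \<Omega> where \<Omega>: "\<Omega> \<in> C" "y = F \<Omega>" by blast
    obtain \<epsilon> \<Psi> where "\<epsilon> > 0"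
      and \<Psi>: "\<And>x. x \<in> ?K \<inter> {F \<Omega> - \<epsilon><..<F \<Omega> + \<epsilon>} \<Longrightarrow> \<Psi> x \<in> C \<and> F (\<Psi> x) = x"
      using local_section[OF \<Omega>(1)] by metis
    have "ball y \<epsilon> \<inter> ?K \<subseteq> F ` C"
    proof
      fix x assume "x \<in> ball y \<epsilon> \<inter> ?K"
      then have "x \<in> ?K \<inter> {F \<Omega> - \<epsilon><..<F \<Omega> + \<epsilon>}"
        by (auto simp: \<Omega>(2) dist_real_def)
      with \<Psi> show "x \<in> F ` C" by (metis imageI)
    qed
    with \<open>\<epsilon> > 0\<close> show "\<exists>e>0. ball y e \<inter> ?K \<subseteq> F ` C" by blast
  qed
  moreover have "closedin (top_of_set ?K) (F ` C)"
    using compact_range sub by (simp add: closed_subset compact_imp_closed)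
  moreover have "F ` C \<noteq> {}"
    using F_not_constant by (auto simp: constant_on_def)
  ultimately show ?thesis
    using connected_clopen[of ?K] by (metis connected_Icc)
qed

section \<open>Existence of constrained minimizers\<close>

lemma closedin_level_sets:
  "closedin mtopology {\<Omega>\<in>C. F \<Omega> = x}" "closedin mtopology {\<Omega>\<in>C. F \<Omega> \<le> x}"
  "closedin mtopology {\<Omega>\<in>C. J \<Omega> \<le> x}"
  using closedin_continuous_map_preimage[OF cont_F, of "{x}"]
    closedin_continuous_map_preimage[OF cont_F, of "{..x}"]
    closedin_continuous_map_preimage[OF cont_J, of "{..x}"]
  by simp_all

lemma ex_solution:
  assumes "x \<in> F ` C"
  shows "\<exists>\<Omega>. is_solution (J, {\<Omega>\<in>C. F \<Omega> = x}) \<Omega>"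
  using assms by (intro compact_space_has_solution[OF compact cont_J closedin_level_sets(1)]) auto

text \<open>The minimum is attained, so the \<open>LEAST\<close> behind \<open>f x\<close> is a
  genuine value of \<open>J\<close> and not an unspecified one.\<close>

lemma ex_minimizer:
  assumes "x \<in> F ` C"
  obtains \<Omega> where "\<Omega> \<in> C" "F \<Omega> = x" "J \<Omega> = f x"
proof -
  obtain \<Omega> where \<Omega>: "is_solution (J, {\<Omega>\<in>C. F \<Omega> = x}) \<Omega>"
    using ex_solution[OF assms] by blast
  then have "f x = J \<Omega>"
    by (simp add: constrained_min_def min_value_eq)
  with \<Omega> that[of \<Omega>] show ?thesis by (simp add: is_solution_iff)
qed

lemma f_le:
  assumes "\<Omega> \<in> C"
  shows "f (F \<Omega>) \<le> J \<Omega>"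
proof -
  obtain \<Omega>' where \<Omega>': "is_solution (J, {\<Omega>'\<in>C. F \<Omega>' = F \<Omega>}) \<Omega>'"
    using ex_solution assms by blast
  then have "f (F \<Omega>) = J \<Omega>'"
    by (simp add: constrained_min_def min_value_eq)
  with \<Omega>' assms show ?thesis by (simp add: is_solution_iff)
qed

section \<open>Saturation and strict decrease\<close>

lemma constraint_saturated:
  assumes \<Omega>: "is_solution (J, {\<Omega>\<in>C. F \<Omega> \<le> x}) \<Omega>" and x: "x \<in> F ` C"
  shows "F \<Omega> = x"
proof (rule ccontr)
  assume "F \<Omega> \<noteq> x"
  with \<Omega> have "\<Omega> \<in> C" "F \<Omega> < x"
    by (auto simp: is_solution_iff)
  have "openin mtopology {\<Omega>\<in>C. F \<Omega> < x}"
    using openin_continuous_map_preimage[OF cont_F, of "{..<x}"] by simp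
  then obtain r where "r > 0" "mball \<Omega> r \<subseteq> {\<Omega>\<in>C. F \<Omega> < x}"
    using \<open>\<Omega> \<in> C\<close> \<open>F \<Omega> < x\<close> unfolding openin_mtopology by blast
  then have "F \<Omega>' < x" if "\<Omega>' \<in> C" "\<delta> \<Omega> \<Omega>' < r" for \<Omega>'
    using that \<open>\<Omega> \<in> C\<close> by (auto simp: subset_iff)
  with \<Omega> \<open>r > 0\<close> have "local_minimizer C \<delta> J \<Omega>"
    by (fastforce simp: local_minimizer_def is_solution_iff)
  \<comment> \<open>Since \<open>x\<close> is itself a value of \<open>F\<close>, it does not exceed
    the supremum, and the hypothesis on local minimizers applies to \<open>\<Omega>\<close>.\<close>
  moreover have "F \<Omega> < Sup (F ` C)"
    using \<open>F \<Omega> < x\<close> x range_bounds(2) by fastforce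
  ultimately show False
    using no_local_minimizer \<open>\<Omega> \<in> C\<close> by blast
qed

text \<open>By compactness \<open>J\<close> has a minimizer on the sublevel set. Saturation puts it
  at level \<open>x\<close>, where \<open>J\<close> is bounded below by \<open>f x\<close>.\<close>

lemma f_le_sublevel:
  assumes "\<Omega> \<in> C" "F \<Omega> \<le> x" "x \<in> F ` C"
  shows "f x \<le> J \<Omega>"
proof -
  obtain \<Omega>' where \<Omega>': "is_solution (J, {\<Omega>\<in>C. F \<Omega> \<le> x}) \<Omega>'"
    using assms compact_space_has_solution[OF compact cont_J closedin_level_sets(2)] by blast
  then have "f x \<le> J \<Omega>'"
    using f_le[of \<Omega>'] constraint_saturated[OF \<Omega>' assms(3)] by (auto simp: is_solution_iff)
  also have "\<dots> \<le> J \<Omega>"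
    using \<Omega>' assms by (auto simp: is_solution_iff)
  finally show ?thesis .
qed

text \<open>Weak decrease holds because sublevel sets grow with the level. If
  \<open>f y = f x\<close> with \<open>x < y\<close>, a minimizer at level \<open>x\<close> would
  also solve the problem with constraint \<open>F \<Omega> \<le> y\<close> without saturating
  it.\<close>

lemma f_strict_antimono: "strict_antimono_on (F ` C) f"
proof (rule monotone_onI)
  fix x y assume x: "x \<in> F ` C" and y: "y \<in> F ` C" and "x < y"
  obtain \<Omega> where \<Omega>: "\<Omega> \<in> C" "F \<Omega> = x" "J \<Omega> = f x"
    using ex_minimizer[OF x] .
  have le: "f y \<le> f x"
    using f_le_sublevel[of \<Omega> y] \<Omega> y \<open>x < y\<close> by simp
  moreover have "f y \<noteq> f x"
  proof
    assume "f y = f x"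
    then have "is_solution (J, {\<Omega>\<in>C. F \<Omega> \<le> y}) \<Omega>"
      using \<Omega> y \<open>x < y\<close> f_le_sublevel[of _ y] by (auto simp: is_solution_iff)
    with constraint_saturated[of y \<Omega>] y \<Omega> \<open>x < y\<close> show False by simp
  qed
  ultimately show "f y < f x" by simp
qed

text \<open>Otherwise strict decrease gives
  \<open>f x < f (F \<Omega>) \<le> J \<Omega>\<close>.\<close>

lemma level_le:
  assumes "\<Omega> \<in> C" "J \<Omega> \<le> f x" "x \<in> F ` C"
  shows "x \<le> F \<Omega>"
proof (rule ccontr)
  assume "\<not> ?thesis"
  then have "f x < f (F \<Omega>)"
    using monotone_onD[OF f_strict_antimono, of "F \<Omega>" x] assms by simp
  with f_le[OF assms(1)] assms(2) show False by simp
qed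

section \<open>Continuity of the optimal value\<close>

lemma f_continuous: "continuous_on (F ` C) f"
  unfolding continuous_on_iff
proof (intro ballI allI impI)
  fix x e :: real assume x: "x \<in> F ` C" and "e > 0"
  obtain \<Omega> where \<Omega>: "\<Omega> \<in> C" "F \<Omega> = x" "J \<Omega> = f x"
    using ex_minimizer[OF x] .
  \<comment> \<open>Upper estimate: \<open>\<Psi>\<close> moves the minimizer
    \<open>\<Omega>\<close> to a competitor at each nearby level \<open>y\<close>, and
    \<open>J \<circ> \<Psi>\<close> is continuous with value \<open>f x\<close> at
    \<open>x\<close>.\<close>
  have "\<exists>d>0. \<forall>y\<in>F ` C. dist y x < d \<longrightarrow> f y < f x + e"
  proof -
    obtain \<epsilon> \<Psi> where "\<epsilon> > 0" "\<Psi> x = \<Omega>"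
      and cont: "continuous_map (top_of_set ({Inf (F ` C)..Sup (F ` C)} \<inter> {x - \<epsilon><..<x + \<epsilon>}))
        mtopology \<Psi>"
      and \<Psi>: "\<And>y. y \<in> {Inf (F ` C)..Sup (F ` C)} \<inter> {x - \<epsilon><..<x + \<epsilon>} \<Longrightarrow> \<Psi> y \<in> C \<and> F (\<Psi> y) = y"
      using local_section[OF \<Omega>(1)] \<Omega>(2) by metis
    let ?U = "F ` C \<inter> {x - \<epsilon><..<x + \<epsilon>}"
    have "continuous_on ?U (J \<circ> \<Psi>)"
      using continuous_map_compose[OF cont cont_J] range_eq by simp
    then obtain d where "d > 0" and d: "\<And>y. y \<in> ?U \<Longrightarrow> dist y x < d \<Longrightarrow> dist (J (\<Psi> y)) (J (\<Psi> x)) < e"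
      using x \<open>e > 0\<close> \<open>\<epsilon> > 0\<close> unfolding continuous_on_iff comp_apply
      by (metis IntI diff_less_eq greaterThanLessThan_iff less_add_same_cancel1)
    \<comment> \<open>The bound \<open>\<epsilon>\<close> keeps \<open>y\<close> where
      \<open>\<Psi>\<close> is a section of \<open>F\<close>.\<close>
    have "f y < f x + e" if y: "y \<in> F ` C" "dist y x < min d \<epsilon>" for y
    proof -
      have yU: "y \<in> ?U"
        using y by (auto simp: dist_real_def)
      then have "\<Psi> y \<in> C \<and> F (\<Psi> y) = y"
        using \<Psi> range_eq by auto
      then have "f y \<le> J (\<Psi> y)"
        using f_le by force
      also have "\<dots> < f x + e"
        using d[OF yU] y \<Omega> \<open>\<Psi> x = \<Omega>\<close> by (auto simp: dist_real_def)
      finally show ?thesis .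
    qed
    with \<open>d > 0\<close> \<open>\<epsilon> > 0\<close> show ?thesis
      by (intro exI[of _ "min d \<epsilon>"]) auto
  qed
  \<comment> \<open>Lower estimate: \<open>f y\<close> is attained, so it exceeds
    \<open>f x - e\<close> unless some set at level \<open>y\<close> has \<open>J\<close> at most
    \<open>f x - e\<close>.\<close>
  moreover have "\<exists>d>0. \<forall>y\<in>F ` C. dist y x < d \<longrightarrow> f x - e < f y"
  proof (cases "{\<Omega>\<in>C. J \<Omega> \<le> f x - e} = {}")
    case True
    have "f x - e < f y" if y: "y \<in> F ` C" for y
    proof -
      obtain \<Omega>' where "\<Omega>' \<in> C" "F \<Omega>' = y" "J \<Omega>' = f y"
        using ex_minimizer[OF y] .
      with True show ?thesis by force
    qed
    then show ?thesis by (intro exI[of _ 1]) simp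
  next
    case False
    \<comment> \<open>The smallest level \<open>F \<Omega>\<^sub>0\<close> at which \<open>J \<le> f x - e\<close> is reachable lies strictly beyond \<open>x\<close>.\<close>
    then obtain \<Omega>\<^sub>0 where "is_solution (F, {\<Omega>\<in>C. J \<Omega> \<le> f x - e}) \<Omega>\<^sub>0"
      using compact_space_has_solution[OF compact cont_F closedin_level_sets(3)] by blast
    then have \<Omega>\<^sub>0: "\<Omega>\<^sub>0 \<in> C" "J \<Omega>\<^sub>0 \<le> f x - e"
      and least: "\<And>\<Omega>. \<Omega> \<in> C \<Longrightarrow> J \<Omega> \<le> f x - e \<Longrightarrow> F \<Omega>\<^sub>0 \<le> F \<Omega>"
      by (auto simp: is_solution_iff)
    have "x \<le> F \<Omega>\<^sub>0"
      using level_le[OF \<Omega>\<^sub>0(1) _ x] \<Omega>\<^sub>0(2) \<open>e > 0\<close> by simp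
    moreover have "x \<noteq> F \<Omega>\<^sub>0"
      using f_le[OF \<Omega>\<^sub>0(1)] \<Omega>\<^sub>0(2) \<open>e > 0\<close> by auto
    ultimately have "x < F \<Omega>\<^sub>0" by simp
    \<comment> \<open>Here \<open>y < F \<Omega>\<^sub>0\<close>, so a minimizer at level
      \<open>y\<close> with \<open>J\<close> at most \<open>f x - e\<close> would contradict the
      choice of \<open>\<Omega>\<^sub>0\<close>.\<close>
    have "f x - e < f y" if y: "y \<in> F ` C" "dist y x < F \<Omega>\<^sub>0 - x" for y
    proof -
      obtain \<Omega>' where "\<Omega>' \<in> C" "F \<Omega>' = y" "J \<Omega>' = f y"
        using ex_minimizer[OF y(1)] .
      with least[of \<Omega>'] y(2) show ?thesis
        by (force simp: dist_real_def)
    qed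
    with \<open>x < F \<Omega>\<^sub>0\<close> show ?thesis
      by (intro exI[of _ "F \<Omega>\<^sub>0 - x"]) simp
  qed
  ultimately obtain d d' where "d > 0" "d' > 0"
    and "\<And>y. y \<in> F ` C \<Longrightarrow> dist y x < d \<Longrightarrow> f y < f x + e"
    and "\<And>y. y \<in> F ` C \<Longrightarrow> dist y x < d' \<Longrightarrow> f x - e < f y"
    by blast
  then show "\<exists>d>0. \<forall>y\<in>F ` C. dist y x < d \<longrightarrow> dist (f y) (f x) < e"
    by (intro exI[of _ "min d d'"]) (force simp: dist_real_def abs_less_iff)
qed

section \<open>Comparison of the four problems\<close>

text \<open>A minimizer \<open>\<Omega>\<^sub>x\<close> at level \<open>x\<close> solves all four
  problems, so the solutions of each are the admissible sets with the same objective value. With an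
  equality constraint this already fixes both \<open>F\<close> and \<open>J\<close>; the inequality
  constraints need to be saturated.\<close>

lemma solutions_eq:
  assumes x: "x \<in> F ` C"
    and P: "P \<in> {(J, {\<Omega>\<in>C. F \<Omega> = x}), (J, {\<Omega>\<in>C. F \<Omega> \<le> x}),
      (F, {\<Omega>\<in>C. J \<Omega> = f x}), (F, {\<Omega>\<in>C. J \<Omega> \<le> f x})}"
  shows "is_solution P \<Omega> \<longleftrightarrow> \<Omega> \<in> C \<and> F \<Omega> = x \<and> J \<Omega> = f x"
proof -
  obtain \<Omega>\<^sub>x where \<Omega>\<^sub>x: "\<Omega>\<^sub>x \<in> C" "F \<Omega>\<^sub>x = x" "J \<Omega>\<^sub>x = f x"
    using ex_minimizer[OF x] .
  have J_ge: "f x \<le> J \<Omega>'" if "\<Omega>' \<in> C" "F \<Omega>' \<le> x" for \<Omega>'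
    using f_le_sublevel that x by blast
  have F_ge: "x \<le> F \<Omega>'" if "\<Omega>' \<in> C" "J \<Omega>' \<le> f x" for \<Omega>'
    using level_le that x by blast
  have "is_solution P \<Omega>\<^sub>x"
    using P J_ge F_ge \<Omega>\<^sub>x by (auto simp: is_solution_iff)
  then have iff: "is_solution P \<Omega> \<longleftrightarrow> \<Omega> \<in> snd P \<and> fst P \<Omega> = fst P \<Omega>\<^sub>x"
    using is_solution_iff_eq by (metis prod.collapse)
  from P consider
      "P = (J, {\<Omega>\<in>C. F \<Omega> = x})" | "P = (J, {\<Omega>\<in>C. F \<Omega> \<le> x})"
    | "P = (F, {\<Omega>\<in>C. J \<Omega> = f x})" | "P = (F, {\<Omega>\<in>C. J \<Omega> \<le> f x})"
    by blast
  then show ?thesis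
  proof cases
    case 2
    then have "F \<Omega> = x" if "is_solution P \<Omega>"
      using constraint_saturated[OF _ x] that by simp
    with 2 iff \<Omega>\<^sub>x show ?thesis by auto
  next
    case 4
    \<comment> \<open>A solution has \<open>F \<Omega> = x\<close>, hence
      \<open>J \<Omega> \<ge> f x\<close>, which turns the constraint on \<open>J\<close> into an
      equality.\<close>
    with iff \<Omega>\<^sub>x J_ge[of \<Omega>] show ?thesis by auto
  qed (use iff \<Omega>\<^sub>x in auto)
qed

lemma equivalent:
  assumes "x \<in> F ` C"
  shows "equivalent_problems
    {(J, {\<Omega>\<in>C. F \<Omega> = x}), (J, {\<Omega>\<in>C. F \<Omega> \<le> x}),
     (F, {\<Omega>\<in>C. J \<Omega> = f x}), (F, {\<Omega>\<in>C. J \<Omega> \<le> f x})}"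
  unfolding equivalent_problems_def using solutions_eq[OF assms] by blast

end

theorem theorem3:
  fixes C :: "(real ^ 'n) set set"
    and \<delta> :: "(real ^ 'n) set \<Rightarrow> (real ^ 'n) set \<Rightarrow> real"
    and J F :: "(real ^ 'n) set \<Rightarrow> real"
    and I :: "real set"
    and f :: "real \<Rightarrow> real"
  assumes dist: "Metric_space C \<delta>"
    and I: "I = {F \<Omega> | \<Omega>. \<Omega> \<in> C}"
    and A: "C \<noteq> {}" "compact_space (Metric_space.mtopology C \<delta>)"
    and B_nonconst: "\<not> F constant_on C" "\<not> J constant_on C"
    and B_cont: "continuous_map (Metric_space.mtopology C \<delta>) euclideanreal F"
                "continuous_map (Metric_space.mtopology C \<delta>) euclideanreal J"
    and C: "\<forall>\<Omega>\<in>C. \<exists>\<epsilon>>0. \<exists>\<Psi>.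
              continuous_map
                (top_of_set ({Inf I..Sup I} \<inter> {F \<Omega> - \<epsilon><..<F \<Omega> + \<epsilon>}))
                (Metric_space.mtopology C \<delta>) \<Psi> \<and>
              \<Psi> (F \<Omega>) = \<Omega> \<and>
              (\<forall>x \<in> {Inf I..Sup I} \<inter> {F \<Omega> - \<epsilon><..<F \<Omega> + \<epsilon>}. F (\<Psi> x) = x)"
    and D: "\<forall>\<Omega>\<in>C. F \<Omega> < Sup I \<longrightarrow> \<not> local_minimizer C \<delta> J \<Omega>"
    and f: "\<forall>x\<in>I. f x = constrained_min C J F x"
  shows "((\<exists>a b. I = {a..b}) \<and> interior I \<noteq> {} \<and> I = closure {Inf I<..<Sup I}) \<and>
    (\<forall>x\<in>I. \<exists>\<Omega>. is_solution (J, {\<Omega>\<in>C. F \<Omega> = x}) \<Omega>) \<and>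
    (continuous_on I f \<and> strict_antimono_on I f) \<and>
    (\<forall>x\<in>I. equivalent_problems
       {(J, {\<Omega>\<in>C. F \<Omega> = x}),
        (J, {\<Omega>\<in>C. F \<Omega> \<le> x}),
        (F, {\<Omega>\<in>C. J \<Omega> = f x}),
        (F, {\<Omega>\<in>C. J \<Omega> \<le> f x})})"
proof -
  have I': "I = F ` C"
    using I by auto
  interpret P: constrained_problem C \<delta> J F
    using A B_nonconst B_cont C D
    by (intro constrained_problem.intro dist constrained_problem_axioms.intro) (simp_all add: I')
  have "continuous_on I f"
    using P.f_continuous f I' by (metis continuous_on_cong)
  moreover have "strict_antimono_on I f"
    using P.f_strict_antimono f I' by (simp add: monotone_on_def)
  \<comment> \<open>Since the endpoints differ, the open interval between them is nonempty and its
    closure is the closed one.\<close>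
  moreover have "I = {Inf I..Sup I}" "Inf I < Sup I"
    using P.range_eq P.Inf_less_Sup I' by simp_all
  then have "(\<exists>a b. I = {a..b}) \<and> interior I \<noteq> {} \<and> I = closure {Inf I<..<Sup I}"
    by (metis closure_greaterThanLessThan greaterThanLessThan_empty_iff interior_atLeastAtMost_real
        linorder_not_le)
  moreover have "\<forall>x\<in>I. equivalent_problems
       {(J, {\<Omega>\<in>C. F \<Omega> = x}), (J, {\<Omega>\<in>C. F \<Omega> \<le> x}),
        (F, {\<Omega>\<in>C. J \<Omega> = f x}), (F, {\<Omega>\<in>C. J \<Omega> \<le> f x})}"
    using P.equivalent f I' by simp
  ultimately show ?thesis
    using P.ex_solution I' by simp
qed

end
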